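(* Let the number of sessions $S$, the finite set $\mathcal{E}$, the permutation $\sigma$ and all system constants be as in the context. For every fixed choice of strictly positive auxiliary variables $Y=\big((y^{(dl)}_{e,\ell'}),(y^{(ul)}_{e,\ell}),(y^{(dl)}_{\ell'}),(y^{(ul)}_{s,\ell}),(y^{(E)}_{s,\ell})\big)$, the problem $(\mathcal{TP})$ defined in the context is a convex optimization problem in its decision variables $X$. That is, $(\mathcal{TP})$ minimizes a convex function of $X$ subject to constraints that are each affine in $X$ or of the form $G(X)\ge 0$ with $G$ concave in $X$ (so in particular its feasible set is convex and its objective is convex on it).
   Context: **Index sets and constants.** $S\ge 1$ is an integer (number of federated-learning users, indexed $1,\dots,S$). $\mathcal{E}$ is a finite set (high-bandwidth users). $\sigma$ is a permutation of $\{1,\dots,S\}$: $\sigma(s)$ is the user whose uplink start is ranked $s$-th. Downlink sessions are indexed by $\ell'\in\{1,\dots,S\}$ and uplink sessions by $\ell\in\{1,\dots,S\}$. The following are given constants: - $K,B,N_0,D,P_{\max},\theta,\kappa,\alpha>0$; - $\Theta_s>0$, $h_s>0$, $\gamma_s>0$, $\tau^{(cp)}_{s,\min}>0$, $\lambda_s\ge 0$ for $s=1,\dots,S$; - $\gamma_e>0$, $r_{e,\max}\ge 0$ for $e\in\mathcal{E}$. Write $c_s=B\log_2(1+\gamma_s)$ and $c_e=B\log_2(1+\gamma_e)$, the rates per resource block in downlink of federated-learning user $s$ and high-bandwidth user $e$. **Decision variables $X$ (all real).** - durations $t^{(dl)}_{\ell'}$, $t^{(ul)}_\ell$, $T_{idle}$;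 - resource blocks $K^{(dl)}_{\ell'}$, $K^{(dl)}_{e,\ell'}$, $K^{(ul)}_{e,\ell}$ for $e\in\mathcal{E}$, and $K^{(ul)}_{\sigma(s),\ell}$ for $1\le s\le \ell\le S$; - powers $p^{(ul)}_{\sigma(s),\ell}$ for $1\le s\le\ell\le S$. **Uplink rate.** For $1\le s\le \ell\le S$, $$r^{(ul)}_{\sigma(s),\ell}=K^{(ul)}_{\sigma(s),\ell}\,B\log_2\!\Big(1+\frac{p^{(ul)}_{\sigma(s),\ell}\,h_{\sigma(s)}}{K^{(ul)}_{\sigma(s),\ell}\,B N_0}\Big),$$ with value $0$ (by continuity) when $K^{(ul)}_{\sigma(s),\ell}=0$. **Computation time.** For $s=1,\dots,S$, $$\tau^{(cp)}_{\sigma(s)}=\sum_{\ell\le s-1}t^{(ul)}_\ell+\sum_{\ell'>\sigma(s)}t^{(dl)}_{\ell'}+T_{idle},$$ which is shorthand for an affine function of the durations, not a variable. **Approximated energy.** For $s=1,\dots,S$, $$\hat E^{(tot)}_{\sigma(s)}=\frac{\kappa\,\alpha^3\,\Theta_{\sigma(s)}^3}{\big(\tau^{(cp)}_{\sigma(s)}\big)^2}+\sum_{\ell\ge s}\left(\frac{\big(p^{(ul)}_{\sigma(s),\ell}\big)^2}{2y^{(E)}_{s,\ell}}+\frac{y^{(E)}_{s,\ell}\big(t^{(ul)}_\ell\big)^2}{2}\right).$$ **Auxiliary variables $Y$ (fixed, strictly positive).** $y^{(dl)}_{e,\ell'}$, $y^{(ul)}_{e,\ell}$ for $e\in\mathcal{E}$;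 $y^{(dl)}_{\ell'}$; $y^{(ul)}_{s,\ell}$ and $y^{(E)}_{s,\ell}$ for $1\le s\le\ell\le S$. **Problem $(\mathcal{TP})$.** Minimize over $X$ $$\sum_{\ell'}t^{(dl)}_{\ell'}+T_{idle}+\sum_{\ell}t^{(ul)}_\ell+\sum_{s=1}^S\lambda_{\sigma(s)}\hat E^{(tot)}_{\sigma(s)}$$ subject to: 1. (high-bandwidth rate) for all $e\in\mathcal{E}$, $$\sum_{\ell'}c_e\Big(2y^{(dl)}_{e,\ell'}\sqrt{K^{(dl)}_{e,\ell'}}-\tfrac{(y^{(dl)}_{e,\ell'})^2}{t^{(dl)}_{\ell'}}\Big)+T_{idle}\,r_{e,\max}+\sum_{\ell}c_e\Big(2y^{(ul)}_{e,\ell}\sqrt{K^{(ul)}_{e,\ell}}-\tfrac{(y^{(ul)}_{e,\ell})^2}{t^{(ul)}_\ell}\Big)\ \ge\ \theta\Big(\sum_{\ell'}t^{(dl)}_{\ell'}+T_{idle}+\sum_\ell t^{(ul)}_\ell\Big);$$ 2. (downlink completion) for all $\ell'$, $$\sum_{i\le \ell'}c_{\ell'}\Big(2y^{(dl)}_i\sqrt{K^{(dl)}_i}-\tfrac{(y^{(dl)}_i)^2}{t^{(dl)}_i}\Big)\ge D;$$ 3. (uplink completion) for all $s=1,\dots,S$, $$\sum_{\ell\ge s}\Big(2y^{(ul)}_{s,\ell}\sqrt{r^{(ul)}_{\sigma(s),\ell}}-\tfrac{(y^{(ul)}_{s,\ell})^2}{t^{(ul)}_\ell}\Big)\ge D;$$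 4. (downlink sharing) for all $\ell'$, $K^{(dl)}_{\ell'}+\sum_{e\in\mathcal{E}}K^{(dl)}_{e,\ell'}\le K$; 5. (uplink sharing) for all $\ell$, $\sum_{s\le\ell}K^{(ul)}_{\sigma(s),\ell}+\sum_{e\in\mathcal{E}}K^{(ul)}_{e,\ell}\le K$; 6. (computation time) for all $s=1,\dots,S$, $\tau^{(cp)}_{\sigma(s)}\ge\tau^{(cp)}_{\sigma(s),\min}$; 7. (power) $p^{(ul)}_{\sigma(s),\ell}\in[0,P_{\max}]$ for $1\le s\le\ell\le S$; 8. (nonnegativity) $t^{(dl)}_{\ell'},t^{(ul)}_\ell,T_{idle},K^{(ul)}_{\sigma(s),\ell},K^{(dl)}_{\ell'},K^{(dl)}_{e,\ell'},K^{(ul)}_{e,\ell}\ge 0$. **Convention.** For $y>0$, the term $-y^2/t$ is understood as the extended-valued concave function of $t\ge 0$ equal to $-\infty$ at $t=0$. The objective is considered on the region where all $\tau^{(cp)}_{\sigma(s)}>0$, which contains the feasible set. *)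

theory Defs
  imports "HOL-Analysis.Analysis" "HOL-Analysis.Finite_Function_Topology"
begin

section \<open>Convex optimization problems\<close>

text \<open>
  An optimization problem ``minimize \<open>f X\<close> subject to \<open>G X \<ge> 0\<close> for all \<open>G \<in> C\<close>'' over a linear
  space \<open>V\<close> of decision vectors. Constraint functions are extended-valued and never \<open>+\<infinity>\<close> where
  concavity is claimed, so \<open>\<infinity> - \<infinity>\<close> cannot arise in the concavity inequality.
\<close>

definition concave_ereal_on :: "'v::real_vector set \<Rightarrow> ('v \<Rightarrow> ereal) \<Rightarrow> bool" where
  "concave_ereal_on A G \<longleftrightarrow>
     convex A \<and> (\<forall>x\<in>A. G x \<noteq> \<infinity>) \<and>
     (\<forall>x\<in>A. \<forall>y\<in>A. \<forall>u>0. \<forall>v>0. u + v = 1 \<longrightarrow>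
        ereal u * G x + ereal v * G y \<le> G (u *\<^sub>R x + v *\<^sub>R y))"

definition affine_fun_on :: "'v::real_vector set \<Rightarrow> ('v \<Rightarrow> ereal) \<Rightarrow> bool" where
  "affine_fun_on V G \<longleftrightarrow>
     (\<exists>f c. linear f \<and> (\<forall>x\<in>V. G x = ereal (f x + c)))"

definition feasible_set :: "'v set \<Rightarrow> ('v \<Rightarrow> ereal) set \<Rightarrow> 'v set" where
  "feasible_set V C = {x \<in> V. \<forall>G\<in>C. G x \<ge> 0}"

text \<open>
  \<open>A\<close> is the region on which the objective is considered, and \<open>A'\<close> the domain of the non-affine
  constraint functions; both have to contain the feasible set.
\<close>

definition convex_problem ::
    "'v::real_vector set \<Rightarrow> 'v set \<Rightarrow> ('v \<Rightarrow> real) \<Rightarrow> 'v set \<Rightarrow> ('v \<Rightarrow> ereal) set \<Rightarrow> bool" where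
  "convex_problem V A f A' C \<longleftrightarrow>
     subspace V \<and> A \<subseteq> V \<and> A' \<subseteq> V \<and>
     feasible_set V C \<subseteq> A \<and> feasible_set V C \<subseteq> A' \<and>
     convex_on A f \<and>
     (\<forall>G\<in>C. affine_fun_on V G \<or> concave_ereal_on A' G)"


section \<open>Data of the problem\<close>

text \<open>
  Federated-learning users and sessions are numbered \<open>1, \<dots>, num_users\<close>; values of indexed constants
  outside their index ranges are irrelevant.
\<close>

record 'e system =
  num_users :: nat
  hb_users :: "'e set"
  sigma :: "nat \<Rightarrow> nat"
  K_tot :: real
  bandwidth :: real
  N_0 :: real
  data_size :: real
  P_max :: real
  theta :: real
  kappa :: real
  alpha :: real
  Theta :: "nat \<Rightarrow> real"
  gain :: "nat \<Rightarrow> real"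
  gamma_fl :: "nat \<Rightarrow> real"
  tau_min :: "nat \<Rightarrow> real"
  lambda :: "nat \<Rightarrow> real"
  gamma_hb :: "'e \<Rightarrow> real"
  r_max :: "'e \<Rightarrow> real"

definition admissible_system :: "'e system \<Rightarrow> bool" where
  "admissible_system P \<longleftrightarrow>
     num_users P \<ge> 1 \<and> finite (hb_users P) \<and> sigma P permutes {1..num_users P} \<and>
     K_tot P > 0 \<and> bandwidth P > 0 \<and> N_0 P > 0 \<and> data_size P > 0 \<and> P_max P > 0 \<and>
     theta P > 0 \<and> kappa P > 0 \<and> alpha P > 0 \<and>
     (\<forall>s\<in>{1..num_users P}.
        Theta P s > 0 \<and> gain P s > 0 \<and> gamma_fl P s > 0 \<and> tau_min P s > 0 \<and> lambda P s \<ge> 0) \<and>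
     (\<forall>e\<in>hb_users P. gamma_hb P e > 0 \<and> r_max P e \<ge> 0)"

definition c_fl :: "'e system \<Rightarrow> nat \<Rightarrow> real" where
  "c_fl P s = bandwidth P * log 2 (1 + gamma_fl P s)"

definition c_hb :: "'e system \<Rightarrow> 'e \<Rightarrow> real" where
  "c_hb P e = bandwidth P * log 2 (1 + gamma_hb P e)"

record 'e aux =
  y_dl_hb :: "'e \<Rightarrow> nat \<Rightarrow> real"
  y_ul_hb :: "'e \<Rightarrow> nat \<Rightarrow> real"
  y_dl :: "nat \<Rightarrow> real"
  y_ul :: "nat \<Rightarrow> nat \<Rightarrow> real"
  y_E :: "nat \<Rightarrow> nat \<Rightarrow> real"

definition positive_aux :: "'e system \<Rightarrow> 'e aux \<Rightarrow> bool" where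
  "positive_aux P Y \<longleftrightarrow>
     (\<forall>l\<in>{1..num_users P}.
        (\<forall>e\<in>hb_users P. y_dl_hb Y e l > 0 \<and> y_ul_hb Y e l > 0) \<and>
        y_dl Y l > 0 \<and>
        (\<forall>s\<in>{1..l}. y_ul Y s l > 0 \<and> y_E Y s l > 0))"


section \<open>Decision variables\<close>

text \<open>
  A decision vector is a finitely supported real function on the names of the variables, supported
  on the names that occur in the problem; these vectors form a copy of \<open>\<real>\<^sup>n\<close>, with \<open>n\<close> the number of
  variables. The first index of \<open>K_ul\<close> and \<open>p_ul\<close> is the user \<open>\<sigma>(s)\<close>, not the rank \<open>s\<close>.
\<close>

datatype 'e var =
    t_dl nat
  | t_ul nat
  | T_idle
  | K_dl nat
  | K_dl_hb 'e nat
  | K_ul_hb 'e nat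
  | K_ul nat nat
  | p_ul nat nat

type_synonym 'e decision = "('e var, real) poly_mapping"

abbreviation val :: "'e decision \<Rightarrow> 'e var \<Rightarrow> real" where
  "val \<equiv> Poly_Mapping.lookup"

definition resource_vars :: "'e system \<Rightarrow> 'e var set" where
  "resource_vars P =
     {K_dl l | l. l \<in> {1..num_users P}} \<union>
     {K_dl_hb e l | e l. e \<in> hb_users P \<and> l \<in> {1..num_users P}} \<union>
     {K_ul_hb e l | e l. e \<in> hb_users P \<and> l \<in> {1..num_users P}} \<union>
     {K_ul (sigma P s) l | s l. 1 \<le> s \<and> s \<le> l \<and> l \<le> num_users P}"

definition session_vars :: "'e system \<Rightarrow> 'e var set" where
  "session_vars P = {t_dl l | l. l \<in> {1..num_users P}} \<union> {t_ul l | l. l \<in> {1..num_users P}}"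

definition power_vars :: "'e system \<Rightarrow> 'e var set" where
  "power_vars P = {p_ul (sigma P s) l | s l. 1 \<le> s \<and> s \<le> l \<and> l \<le> num_users P}"

definition decision_space :: "'e system \<Rightarrow> 'e decision set" where
  "decision_space P =
     {X. Poly_Mapping.keys X \<subseteq> session_vars P \<union> {T_idle} \<union> resource_vars P \<union> power_vars P}"


section \<open>The problem\<close>

text \<open>In the following, \<open>s\<close> is the rank of the user \<open>\<sigma>(s)\<close> in the uplink order.\<close>

definition ul_rate :: "'e system \<Rightarrow> nat \<Rightarrow> nat \<Rightarrow> 'e decision \<Rightarrow> real" where
  "ul_rate P s l X =
     (let u = sigma P s; k = val X (K_ul u l)
      in if k = 0 then 0
         else k * bandwidth P *
              log 2 (1 + val X (p_ul u l) * gain P u / (k * bandwidth P * N_0 P)))"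

definition tau_cp :: "'e system \<Rightarrow> nat \<Rightarrow> 'e decision \<Rightarrow> real" where
  "tau_cp P s X =
     (\<Sum>l\<in>{1..<s}. val X (t_ul l)) + (\<Sum>l\<in>{sigma P s<..num_users P}. val X (t_dl l)) + val X T_idle"

definition energy :: "'e system \<Rightarrow> 'e aux \<Rightarrow> nat \<Rightarrow> 'e decision \<Rightarrow> real" where
  "energy P Y s X =
     kappa P * alpha P ^ 3 * Theta P (sigma P s) ^ 3 / (tau_cp P s X)\<^sup>2 +
     (\<Sum>l\<in>{s..num_users P}.
        (val X (p_ul (sigma P s) l))\<^sup>2 / (2 * y_E Y s l) + y_E Y s l * (val X (t_ul l))\<^sup>2 / 2)"

definition total_time :: "'e system \<Rightarrow> 'e decision \<Rightarrow> real" where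
  "total_time P X =
     (\<Sum>l\<in>{1..num_users P}. val X (t_dl l)) + val X T_idle + (\<Sum>l\<in>{1..num_users P}. val X (t_ul l))"

definition objective :: "'e system \<Rightarrow> 'e aux \<Rightarrow> 'e decision \<Rightarrow> real" where
  "objective P Y X =
     total_time P X + (\<Sum>s\<in>{1..num_users P}. lambda P (sigma P s) * energy P Y s X)"

definition objective_region :: "'e system \<Rightarrow> 'e decision set" where
  "objective_region P = {X \<in> decision_space P. \<forall>s\<in>{1..num_users P}. tau_cp P s X > 0}"

text \<open>
  \<open>qt y a t\<close> is \<open>2 y \<surd>a - y\<^sup>2/t\<close>, where \<open>- y\<^sup>2/t\<close> is \<open>-\<infinity>\<close> at \<open>t = 0\<close>, and also for \<open>t < 0\<close>, which
  is outside its domain.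
\<close>

definition qt :: "real \<Rightarrow> real \<Rightarrow> real \<Rightarrow> ereal" where
  "qt y a t = ereal (2 * y * sqrt a) + (if t > 0 then ereal (- (y\<^sup>2 / t)) else - \<infinity>)"

text \<open>Each constraint function is the side of its constraint that has to be larger, minus the other side.\<close>

definition hb_rate_con :: "'e system \<Rightarrow> 'e aux \<Rightarrow> 'e \<Rightarrow> 'e decision \<Rightarrow> ereal" where
  "hb_rate_con P Y e X =
     (\<Sum>l\<in>{1..num_users P}.
        ereal (c_hb P e) * qt (y_dl_hb Y e l) (val X (K_dl_hb e l)) (val X (t_dl l))) +
     ereal (val X T_idle * r_max P e) +
     (\<Sum>l\<in>{1..num_users P}.
        ereal (c_hb P e) * qt (y_ul_hb Y e l) (val X (K_ul_hb e l)) (val X (t_ul l))) -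
     ereal (theta P * total_time P X)"

definition dl_completion_con :: "'e system \<Rightarrow> 'e aux \<Rightarrow> nat \<Rightarrow> 'e decision \<Rightarrow> ereal" where
  "dl_completion_con P Y l X =
     (\<Sum>i\<in>{1..l}. ereal (c_fl P l) * qt (y_dl Y i) (val X (K_dl i)) (val X (t_dl i))) -
     ereal (data_size P)"

definition ul_completion_con :: "'e system \<Rightarrow> 'e aux \<Rightarrow> nat \<Rightarrow> 'e decision \<Rightarrow> ereal" where
  "ul_completion_con P Y s X =
     (\<Sum>l\<in>{s..num_users P}. qt (y_ul Y s l) (ul_rate P s l X) (val X (t_ul l))) -
     ereal (data_size P)"

definition dl_sharing_con :: "'e system \<Rightarrow> nat \<Rightarrow> 'e decision \<Rightarrow> ereal" where
  "dl_sharing_con P l X =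
     ereal (K_tot P - (val X (K_dl l) + (\<Sum>e\<in>hb_users P. val X (K_dl_hb e l))))"

definition ul_sharing_con :: "'e system \<Rightarrow> nat \<Rightarrow> 'e decision \<Rightarrow> ereal" where
  "ul_sharing_con P l X =
     ereal (K_tot P -
       ((\<Sum>s\<in>{1..l}. val X (K_ul (sigma P s) l)) + (\<Sum>e\<in>hb_users P. val X (K_ul_hb e l))))"

definition comp_time_con :: "'e system \<Rightarrow> nat \<Rightarrow> 'e decision \<Rightarrow> ereal" where
  "comp_time_con P s X = ereal (tau_cp P s X - tau_min P (sigma P s))"

definition nonneg_con :: "'e var \<Rightarrow> 'e decision \<Rightarrow> ereal" where
  "nonneg_con v X = ereal (val X v)"

definition power_max_con :: "'e system \<Rightarrow> 'e var \<Rightarrow> 'e decision \<Rightarrow> ereal" where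
  "power_max_con P v X = ereal (P_max P - val X v)"

definition constraint_set :: "'e system \<Rightarrow> 'e aux \<Rightarrow> ('e decision \<Rightarrow> ereal) set" where
  "constraint_set P Y =
     hb_rate_con P Y ` hb_users P \<union>
     dl_completion_con P Y ` {1..num_users P} \<union>
     ul_completion_con P Y ` {1..num_users P} \<union>
     dl_sharing_con P ` {1..num_users P} \<union>
     ul_sharing_con P ` {1..num_users P} \<union>
     comp_time_con P ` {1..num_users P} \<union>
     nonneg_con ` power_vars P \<union>
     power_max_con P ` power_vars P \<union>
     nonneg_con ` (session_vars P \<union> {T_idle} \<union> resource_vars P)"

text \<open>
  The domain on which the terms \<open>\<surd>K\<close>, \<open>- y\<^sup>2/t\<close> and the uplink rates are defined. Library functions
  such as \<open>sqrt\<close> are total, and their values outside this domain have no meaning here.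
\<close>

definition constraint_domain :: "'e system \<Rightarrow> 'e decision set" where
  "constraint_domain P =
     {X \<in> decision_space P. \<forall>v \<in> session_vars P \<union> resource_vars P \<union> power_vars P. val X v \<ge> 0}"

end

theory Submission
  imports Defs
begin

text \<open>
  Every non-affine term is obtained from linear functions by a concavity-preserving composition. The
  uplink rate is the perspective \<open>k ln (1 + c p / k)\<close> of a concave function: it is positively
  homogeneous, and Jensen's inequality for \<open>ln\<close> with the weights \<open>k\<^sub>i / (k\<^sub>1 + k\<^sub>2)\<close> makes it
  superadditive, hence concave. The square root is concave and increasing, and so is \<open>-y\<^sup>2/t\<close>, also
  with the value \<open>-\<infinity>\<close> at \<open>t = 0\<close>. In the objective, \<open>1/\<tau>\<^sup>2\<close> and the squares are convex
  functions of linear ones.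
\<close>

section \<open>Convex and concave functions\<close>

lemma convex_on_linear:
  fixes f :: "'a::real_vector \<Rightarrow> real"
  assumes "linear f" "convex A"
  shows "convex_on A f"
  using assms by (simp add: convex_on_def linear_add linear_cmul)

lemma concave_on_linear:
  fixes f :: "'a::real_vector \<Rightarrow> real"
  assumes "linear f" "convex A"
  shows "concave_on A f"
  using assms by (simp add: concave_on_iff linear_add linear_cmul)

lemma convex_on_compose_linear:
  fixes f :: "'a::real_vector \<Rightarrow> 'b::real_vector"
  assumes "convex_on T g" "linear f" "convex A" "f ` A \<subseteq> T"
  shows "convex_on A (\<lambda>x. g (f x))"
  using assms by (simp add: convex_on_def linear_add linear_cmul image_subset_iff)

text \<open>Concavity of \<open>f\<close> only bounds its value at the combined point from below by
  the combined values; monotonicity of \<open>g\<close> carries that bound through. Convexity of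
  \<open>T\<close> keeps the combined values inside the domain of \<open>g\<close>.\<close>

lemma concave_on_compose_mono:
  fixes g :: "real \<Rightarrow> real"
  assumes g: "concave_on T g" "mono_on T g" and f: "concave_on A f" "f ` A \<subseteq> T"
  shows "concave_on A (\<lambda>x. g (f x))"
  unfolding concave_on_iff
proof (intro conjI ballI allI impI)
  show A: "convex A"
    using f concave_on_imp_convex by blast
  fix x y and u v :: real
  assume xy: "x \<in> A" "y \<in> A" and uv: "0 \<le> u" "0 \<le> v" "u + v = 1"
  have fT: "f x \<in> T" "f y \<in> T"
    using f(2) xy by auto
  have T: "u * f x + v * f y \<in> T"
    using convexD[OF concave_on_imp_convex[OF g(1)] fT uv] by simp
  have "u * g (f x) + v * g (f y) \<le> g (u * f x + v * f y)"
    using g(1) fT uv by (simp add: concave_on_iff)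
  also have "\<dots> \<le> g (f (u *\<^sub>R x + v *\<^sub>R y))"
  proof (rule mono_onD[OF g(2) T])
    show "f (u *\<^sub>R x + v *\<^sub>R y) \<in> T"
      using f(2) convexD[OF A xy uv] by auto
    show "u * f x + v * f y \<le> f (u *\<^sub>R x + v *\<^sub>R y)"
      using f(1) xy uv by (simp add: concave_on_iff)
  qed
  finally show "u * g (f x) + v * g (f y) \<le> g (f (u *\<^sub>R x + v *\<^sub>R y))" .
qed

text \<open>\<open>convex A\<close> is assumed separately because an empty or infinite
  \<open>I\<close> yields the zero function, with no summand to supply it.\<close>

lemma convex_on_sum_functions:
  assumes "convex A" "\<And>i. i \<in> I \<Longrightarrow> convex_on A (f i)"
  shows "convex_on A (\<lambda>x. \<Sum>i\<in>I. f i x)"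
  using assms(2)
  by (induction I rule: infinite_finite_induct) (auto simp: convex_on_const \<open>convex A\<close>)

lemma concave_on_sqrt: "concave_on {0..} sqrt"
  unfolding concave_on_iff
proof (intro conjI ballI allI impI)
  fix a b u v :: real
  assume ab: "a \<in> {0..}" "b \<in> {0..}" and uv: "0 \<le> u" "0 \<le> v" "u + v = 1"
  \<comment> \<open>Squaring reduces the claim to convexity of the square at the points
    \<open>sqrt a\<close> and \<open>sqrt b\<close>.\<close>
  have "(u *\<^sub>R sqrt a + v *\<^sub>R sqrt b)\<^sup>2 \<le> u * (sqrt a)\<^sup>2 + v * (sqrt b)\<^sup>2"
    using convex_power2 uv unfolding convex_on_def by blast
  then show "u * sqrt a + v * sqrt b \<le> sqrt (u *\<^sub>R a + v *\<^sub>R b)"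
    using ab by (intro real_le_rsqrt) simp
qed simp

lemma convex_on_inverse_power2: "convex_on {0<..} (\<lambda>x::real. 1 / x\<^sup>2)"
proof (rule f''_ge0_imp_convex)
  fix x :: real assume x: "x \<in> {0<..}"
  show "((\<lambda>x. 1 / x\<^sup>2) has_real_derivative - 2 / x ^ 3) (at x)"
    using x by (auto intro!: derivative_eq_intros simp: field_simps power_numeral_reduce)
  show "((\<lambda>x. - 2 / x ^ 3) has_real_derivative 6 / x ^ 4) (at x)"
    using x by (auto intro!: derivative_eq_intros simp: field_simps power_numeral_reduce)
qed auto

text \<open>The case \<open>k = 0\<close> is covered by the junk value \<open>p / 0 = 0\<close>.\<close>

lemma perspective_ln_superadditive:
  fixes c k k' p p' :: real
  assumes "c \<ge> 0" "k \<ge> 0" "k' \<ge> 0" "p \<ge> 0" "p' \<ge> 0"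
  shows "k * ln (1 + c * p / k) + k' * ln (1 + c * p' / k')
           \<le> (k + k') * ln (1 + c * (p + p') / (k + k'))"
proof -
  \<comment> \<open>If one resource vanishes, its summand is 0 and the claim reduces to the other
    summand growing when its power is increased.\<close>
  have mono: "l * ln (1 + c * q / l) \<le> l * ln (1 + c * (q + q') / l)"
    if "l \<ge> 0" "q \<ge> 0" "q' \<ge> 0" for l q q'
  proof (cases "l = 0")
    case False
    have "c * q / l \<le> c * (q + q') / l" "0 \<le> c * q / l"
      using that \<open>c \<ge> 0\<close> by (auto intro!: divide_right_mono mult_left_mono)
    then show ?thesis
      using that by (intro mult_left_mono) auto
  qed simp
  consider "k = 0" | "k' = 0" | "k > 0" "k' > 0"
    using assms by fastforce
  then show ?thesis
  proof cases
    case 1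
    then show ?thesis using mono[of k' p' p] assms by (simp add: add.commute)
  next
    case 2
    then show ?thesis using mono[of k p p'] assms by simp
  next
    case 3
    \<comment> \<open>Under these weights \<open>u * (c * p / k)\<close> becomes
      \<open>c * p / (k + k')\<close>, so the Jensen average is exactly the argument of
      \<open>ln\<close> on the right.\<close>
    define u v where "u = k / (k + k')" and "v = k' / (k + k')"
    have uv: "u \<ge> 0" "v \<ge> 0" "u + v = 1"
      using 3 by (auto simp: u_def v_def simp flip: add_divide_distrib)
    have pos: "1 + c * p / k > 0" "1 + c * p' / k' > 0"
      using assms 3 by (auto intro!: add_pos_nonneg)
    have "u * ln (1 + c * p / k) + v * ln (1 + c * p' / k')
            \<le> ln (u * (1 + c * p / k) + v * (1 + c * p' / k'))"
      using ln_concave uv pos unfolding concave_on_iff by fastforce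
    also have "u * (1 + c * p / k) + v * (1 + c * p' / k') = 1 + c * (p + p') / (k + k')"
    proof -
      have "u * (c * p / k) + v * (c * p' / k') = c * (p + p') / (k + k')"
        using 3 by (simp add: u_def v_def add_divide_distrib distrib_left)
      then show ?thesis
        using uv by (simp add: distrib_left)
    qed
    finally have "(k + k') * (u * ln (1 + c * p / k) + v * ln (1 + c * p' / k'))
        \<le> (k + k') * ln (1 + c * (p + p') / (k + k'))"
      using 3 by (intro mult_left_mono) auto
    moreover have "(k + k') * u = k" "(k + k') * v = k'"
      using 3 by (auto simp: u_def v_def)
    ultimately show ?thesis
      by (simp add: distrib_left mult.assoc[symmetric])
  qed
qed

lemma concave_on_perspective_ln:
  assumes "linear k" "linear p" "convex A" "c \<ge> 0"
    and "\<And>x. x \<in> A \<Longrightarrow> k x \<ge> 0" "\<And>x. x \<in> A \<Longrightarrow> p x \<ge> 0"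
  shows "concave_on A (\<lambda>x. k x * ln (1 + c * p x / k x))"
  unfolding concave_on_iff
proof (intro conjI ballI allI impI)
  fix x y and u v :: real
  assume xy: "x \<in> A" "y \<in> A" and uv: "0 \<le> u" "0 \<le> v" "u + v = 1"
  \<comment> \<open>Homogeneity lets the weights be absorbed into the arguments, so that
    superadditivity becomes concavity. For \<open>w = 0\<close> both sides are 0; otherwise the
    ratio is unchanged.\<close>
  have hom: "w * (k z * ln (1 + c * p z / k z)) = w * k z * ln (1 + c * (w * p z) / (w * k z))"
    for w z
    by (cases "w = 0") (auto simp: mult.left_commute[of c])
  show "u * (k x * ln (1 + c * p x / k x)) + v * (k y * ln (1 + c * p y / k y))
      \<le> k (u *\<^sub>R x + v *\<^sub>R y) * ln (1 + c * p (u *\<^sub>R x + v *\<^sub>R y) / k (u *\<^sub>R x + v *\<^sub>R y))"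
    using perspective_ln_superadditive[of c "u * k x" "v * k y" "u * p x" "v * p y"] assms xy uv
    by (simp add: hom linear_add linear_cmul)
qed (fact \<open>convex A\<close>)


section \<open>Extended-valued concave functions\<close>

lemma concave_ereal_on_ereal:
  assumes "concave_on A f"
  shows "concave_ereal_on A (\<lambda>x. ereal (f x))"
  using assms by (auto simp: concave_ereal_on_def concave_on_iff)

text \<open>Since no value is infinity, sums never meet opposite infinities, and the weights can be
  distributed and the terms regrouped as over the reals.\<close>

lemma concave_ereal_on_add:
  assumes "concave_ereal_on A F" "concave_ereal_on A G"
  shows "concave_ereal_on A (\<lambda>x. F x + G x)"
  unfolding concave_ereal_on_def
proof (intro conjI ballI allI impI)
  show "convex A" using assms by (simp add: concave_ereal_on_def)
  show "F x + G x \<noteq> \<infinity>" if "x \<in> A" for x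
    using assms that by (simp add: concave_ereal_on_def)
  fix x y and u v :: real
  assume xy: "x \<in> A" "y \<in> A" and uv: "u > 0" "v > 0" "u + v = 1"
  have fin: "F x \<noteq> \<infinity>" "G x \<noteq> \<infinity>" "F y \<noteq> \<infinity>" "G y \<noteq> \<infinity>"
    using assms xy by (auto simp: concave_ereal_on_def)
  have "ereal u * (F x + G x) + ereal v * (F y + G y)
      = (ereal u * F x + ereal v * F y) + (ereal u * G x + ereal v * G y)"
    using fin uv
    by (cases "F x"; cases "G x"; cases "F y"; cases "G y") (auto simp: algebra_simps)
  also have "\<dots> \<le> F (u *\<^sub>R x + v *\<^sub>R y) + G (u *\<^sub>R x + v *\<^sub>R y)"
    using assms xy uv by (intro add_mono) (auto simp: concave_ereal_on_def)
  finally show "ereal u * (F x + G x) + ereal v * (F y + G y)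
      \<le> F (u *\<^sub>R x + v *\<^sub>R y) + G (u *\<^sub>R x + v *\<^sub>R y)" .
qed

lemma concave_ereal_on_diff_ereal:
  assumes "concave_ereal_on A F" "convex_on A g"
  shows "concave_ereal_on A (\<lambda>x. F x - ereal (g x))"
  using concave_ereal_on_add[OF assms(1) concave_ereal_on_ereal, of "\<lambda>x. - g x"] assms(2)
  by (simp add: concave_on_def minus_ereal_def)

text \<open>The case \<open>c = 0\<close> is harmless: the product is 0 even where \<open>F\<close>
  is minus infinity, so the scaled function is constant.\<close>

lemma concave_ereal_on_cmult:
  assumes "c \<ge> 0" "concave_ereal_on A F"
  shows "concave_ereal_on A (\<lambda>x. ereal c * F x)"
  unfolding concave_ereal_on_def
proof (intro conjI ballI allI impI)
  show "convex A" using assms by (simp add: concave_ereal_on_def)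
  show "ereal c * F x \<noteq> \<infinity>" if "x \<in> A" for x
    using assms that by (cases "F x") (auto simp: concave_ereal_on_def)
  fix x y and u v :: real
  assume xy: "x \<in> A" "y \<in> A" and uv: "u > 0" "v > 0" "u + v = 1"
  have fin: "F x \<noteq> \<infinity>" "F y \<noteq> \<infinity>"
    using assms xy by (auto simp: concave_ereal_on_def)
  have "ereal u * (ereal c * F x) + ereal v * (ereal c * F y)
      = ereal c * (ereal u * F x + ereal v * F y)"
    using fin uv \<open>c \<ge> 0\<close> by (cases "F x"; cases "F y") (auto simp: algebra_simps)
  also have "\<dots> \<le> ereal c * F (u *\<^sub>R x + v *\<^sub>R y)"
    using assms xy uv by (intro ereal_mult_left_mono) (auto simp: concave_ereal_on_def)
  finally show "ereal u * (ereal c * F x) + ereal v * (ereal c * F y)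
      \<le> ereal c * F (u *\<^sub>R x + v *\<^sub>R y)" .
qed

lemma concave_ereal_on_sum:
  assumes "convex A" "\<And>i. i \<in> I \<Longrightarrow> concave_ereal_on A (F i)"
  shows "concave_ereal_on A (\<lambda>x. \<Sum>i\<in>I. F i x)"
  using assms(2)
proof (induction I rule: infinite_finite_induct)
  case (insert i I)
  then show ?case by (simp add: concave_ereal_on_add)
qed (auto simp: concave_ereal_on_def zero_ereal_def \<open>convex A\<close>)

text \<open>On positive values the inverse is decreasing and convex, so a concave \<open>t\<close>
  suffices. At points with \<open>t\<close> nonpositive the value minus infinity makes the
  inequality trivial.\<close>

lemma concave_ereal_on_neg_inverse:
  assumes "concave_on A t" "c \<ge> 0"
  shows "concave_ereal_on A (\<lambda>x. if t x > 0 then ereal (- (c / t x)) else - \<infinity>)"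
  unfolding concave_ereal_on_def
proof (intro conjI ballI allI impI)
  show "convex A" using assms concave_on_imp_convex by blast
  fix x y and u v :: real
  assume xy: "x \<in> A" "y \<in> A" and uv: "u > 0" "v > 0" "u + v = 1"
  show "ereal u * (if t x > 0 then ereal (- (c / t x)) else - \<infinity>) +
      ereal v * (if t y > 0 then ereal (- (c / t y)) else - \<infinity>)
    \<le> (if t (u *\<^sub>R x + v *\<^sub>R y) > 0 then ereal (- (c / t (u *\<^sub>R x + v *\<^sub>R y))) else - \<infinity>)"
  proof (cases "t x > 0 \<and> t y > 0")
    case True
    \<comment> \<open>The average \<open>?m\<close> separates the two effects: concavity of
      \<open>t\<close> with antitonicity of the inverse above it, convexity of the inverse at
      it.\<close>
    let ?m = "u * t x + v * t y"
    have m: "0 < ?m" "?m \<le> t (u *\<^sub>R x + v *\<^sub>R y)"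
      using True uv assms(1) xy by (auto simp: concave_on_iff intro: add_pos_pos)
    have "inverse (u *\<^sub>R t x + v *\<^sub>R t y) \<le> u * inverse (t x) + v * inverse (t y)"
      using convex_on_inverse[of "{0<..}"] True uv unfolding convex_on_def by auto
    moreover have "inverse (t (u *\<^sub>R x + v *\<^sub>R y)) \<le> inverse ?m"
      using m by (intro le_imp_inverse_le) auto
    ultimately have "c * inverse (t (u *\<^sub>R x + v *\<^sub>R y)) \<le> c * (u * inverse (t x) + v * inverse (t y))"
      using \<open>c \<ge> 0\<close> by (intro mult_left_mono) auto
    then have "u * - (c / t x) + v * - (c / t y) \<le> - (c / t (u *\<^sub>R x + v *\<^sub>R y))"
      by (simp add: divide_inverse algebra_simps)
    then show ?thesis
      using True m by simp
  next
    \<comment> \<open>A strictly positive weight times minus infinity is minus infinity, and the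
      other summand is not infinity, so the left side is minus infinity.\<close>
    case False
    then show ?thesis using uv by auto
  qed
qed auto

text \<open>Here \<open>a\<close> may be any nonnegative concave function, not just a coordinate, so
  that the uplink rate can be inserted.\<close>

lemma concave_ereal_on_qt:
  assumes "y \<ge> 0" "concave_on A a" "\<And>x. x \<in> A \<Longrightarrow> a x \<ge> 0" "concave_on A t"
  shows "concave_ereal_on A (\<lambda>x. qt y (a x) (t x))"
  unfolding qt_def
proof (rule concave_ereal_on_add)
  have "concave_on A (\<lambda>x. sqrt (a x))"
    by (rule concave_on_compose_mono[OF concave_on_sqrt])
      (use assms in \<open>auto simp: mono_on_def\<close>)
  then show "concave_ereal_on A (\<lambda>x. ereal (2 * y * sqrt (a x)))"
    using \<open>y \<ge> 0\<close> by (intro concave_ereal_on_ereal concave_on_cmul) auto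
  show "concave_ereal_on A (\<lambda>x. if t x > 0 then ereal (- (y\<^sup>2 / t x)) else - \<infinity>)"
    by (rule concave_ereal_on_neg_inverse) (use assms in auto)
qed


section \<open>Convex problems\<close>

text \<open>Feasible points lie in both \<open>V\<close> and \<open>A'\<close>, so each constraint,
  affine or concave, bounds its value at a convex combination below by a nonnegative combination of
  nonnegative values.\<close>

lemma convex_problem_feasible_set:
  assumes "convex_problem V A f A' C"
  shows "convex (feasible_set V C)"
  unfolding convex_def
proof (intro ballI allI impI)
  fix x y and u v :: real
  assume x: "x \<in> feasible_set V C" and y: "y \<in> feasible_set V C"
    and uv: "0 \<le> u" "0 \<le> v" "u + v = 1"
  let ?z = "u *\<^sub>R x + v *\<^sub>R y"
  show "?z \<in> feasible_set V C"
  \<comment> \<open>Extended concavity speaks of strictly positive weights only, since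
    \<open>0 * (-\<infinity>) = 0\<close>; for a zero weight \<open>?z\<close> is one of the two
    given points.\<close>
  proof (cases "u = 0 \<or> v = 0")
    case True
    then show ?thesis using x y uv by auto
  next
    case False
    then have pos: "u > 0" "v > 0" using uv by auto
    have V: "x \<in> V" "y \<in> V" "?z \<in> V"
      using assms x y by (auto simp: convex_problem_def feasible_set_def subspace_add subspace_scale)
    have A': "x \<in> A'" "y \<in> A'"
      using assms x y unfolding convex_problem_def by blast+
    have "G ?z \<ge> 0" if G: "G \<in> C" for G
    proof -
      have nn: "G x \<ge> 0" "G y \<ge> 0"
        using x y G unfolding feasible_set_def by blast+
      have "affine_fun_on V G \<or> concave_ereal_on A' G"
        using assms G by (simp add: convex_problem_def)
      then show ?thesis
      proof
        assume "affine_fun_on V G"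
        then obtain g c where lin: "linear g" and eq: "\<And>x. x \<in> V \<Longrightarrow> G x = ereal (g x + c)"
          by (auto simp: affine_fun_on_def)
        have "g ?z = u * g x + v * g y"
          by (simp add: linear_add[OF lin] linear_cmul[OF lin])
        then have "g ?z + (u + v) * c = u * (g x + c) + v * (g y + c)"
          by (simp add: algebra_simps)
        moreover have "g x + c \<ge> 0" "g y + c \<ge> 0"
          using nn eq[OF V(1)] eq[OF V(2)] by auto
        ultimately have "g ?z + c \<ge> 0"
          using uv by simp
        then show ?thesis
          by (simp add: eq[OF V(3)])
      next
        assume "concave_ereal_on A' G"
        then have "ereal u * G x + ereal v * G y \<le> G ?z"
          using A' pos uv by (auto simp: concave_ereal_on_def)
        moreover have "0 \<le> ereal u * G x + ereal v * G y"
          using nn uv by (intro add_nonneg_nonneg) (auto simp: ereal_zero_le_0_iff)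
        ultimately show ?thesis by simp
      qed
    qed
    with V show ?thesis by (simp add: feasible_set_def)
  qed
qed

lemma affine_fun_on_diff_const:
  assumes "linear f"
  shows "affine_fun_on V (\<lambda>x. ereal (f x - c))"
  unfolding affine_fun_on_def using assms by (intro exI[of _ f] exI[of _ "- c"]) simp

lemma affine_fun_on_const_diff:
  assumes "linear f"
  shows "affine_fun_on V (\<lambda>x. ereal (c - f x))"
  unfolding affine_fun_on_def using linear_compose_neg[OF assms]
  by (intro exI[of _ "\<lambda>x. - f x"] exI[of _ c]) simp


section \<open>The terms of the problem\<close>

lemma lookup_scaleR: "val (r *\<^sub>R X) v = r * val X v"
proof -
  \<comment> \<open>Scaling is defined by abstracting a pointwise product; evaluating it requires
    the finite support of that product.\<close>
  have "finite {i. r * val X i \<noteq> 0}"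
    by (rule finite_subset[OF _ finite_keys[of X]]) (auto simp: in_keys_iff)
  then show ?thesis
    by (simp add: scaleR_poly_mapping_def)
qed

lemma linear_val: "linear (\<lambda>X. val X v)"
  by (rule linearI) (simp_all add: lookup_add lookup_scaleR)

lemmas linear_val_intros = linear_compose_add linear_compose_sum linear_val

lemma linear_tau_cp: "linear (tau_cp P s)"
  unfolding tau_cp_def by (intro linear_val_intros ballI)

lemma linear_total_time: "linear (total_time P)"
  unfolding total_time_def by (intro linear_val_intros ballI)

lemma subspace_decision_space: "subspace (decision_space P)"
proof -
  let ?S = "session_vars P \<union> {T_idle} \<union> resource_vars P \<union> power_vars P"
  \<comment> \<open>Support containment becomes the vanishing of all other coordinates, which linear
    operations visibly preserve.\<close>
  have "decision_space P = {X. \<forall>v. v \<notin> ?S \<longrightarrow> val X v = 0}"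
    unfolding decision_space_def by (auto simp: subset_iff in_keys_iff)
  then show ?thesis
    by (simp add: subspace_def lookup_add lookup_scaleR)
qed

lemma convex_constraint_domain: "convex (constraint_domain P)"
  unfolding constraint_domain_def convex_def
  by (auto simp: subspace_decision_space subspace_add subspace_scale lookup_add lookup_scaleR)

lemma convex_objective_region: "convex (objective_region P)"
  unfolding convex_def
proof (intro ballI allI impI)
  fix X X' and u v :: real
  assume X: "X \<in> objective_region P" "X' \<in> objective_region P"
    and uv: "0 \<le> u" "0 \<le> v" "u + v = 1"
  have "u * tau_cp P s X + v * tau_cp P s X' > 0" if "s \<in> {1..num_users P}" for s
  proof -
    have "tau_cp P s X > 0" "tau_cp P s X' > 0"
      using X that by (auto simp: objective_region_def)
    then show ?thesis
      \<comment> \<open>The weights sum to 1, so at least one of them is positive and strict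
        positivity survives.\<close>
      using uv by (cases "u = 0") (auto intro: add_pos_nonneg)
  qed
  then show "u *\<^sub>R X + v *\<^sub>R X' \<in> objective_region P"
    using X linear_tau_cp[of P] subspace_decision_space[of P]
    by (auto simp: objective_region_def subspace_add subspace_scale linear_add linear_cmul)
qed

section \<open>Uplink rates and feasibility for a fixed system\<close>

context
  fixes P :: "'e system" and Y :: "'e aux"
  assumes adm: "admissible_system P" and pos_aux: "positive_aux P Y"
begin

lemma sigma_in_users: "s \<in> {1..num_users P} \<Longrightarrow> sigma P s \<in> {1..num_users P}"
  using adm permutes_in_image unfolding admissible_system_def by metis

lemma c_fl_nonneg: "l \<in> {1..num_users P} \<Longrightarrow> c_fl P l \<ge> 0"
  using adm by (simp add: admissible_system_def c_fl_def add_pos_pos less_imp_le)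

lemma c_hb_nonneg: "e \<in> hb_users P \<Longrightarrow> c_hb P e \<ge> 0"
  using adm by (simp add: admissible_system_def c_hb_def add_pos_pos less_imp_le)

text \<open>Exhibits the rate as a scaled perspective of \<open>ln\<close>. The case distinction at
  zero resources disappears because the outer factor is then 0.\<close>

lemma ul_rate_eq:
  "ul_rate P s l X = (bandwidth P / ln 2) *
     (val X (K_ul (sigma P s) l) * ln (1 + (gain P (sigma P s) / (bandwidth P * N_0 P)) *
        val X (p_ul (sigma P s) l) / val X (K_ul (sigma P s) l)))"
  by (simp add: ul_rate_def Let_def log_def field_simps)

text \<open>The condition \<open>s \<le> l\<close> ensures that the resource and power variables
  occur in the problem, hence are nonnegative on the domain. Both claims then follow from the
  perspective form.\<close>

lemma
  assumes "s \<in> {1..num_users P}" "l \<in> {s..num_users P}"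
  shows concave_on_ul_rate: "concave_on (constraint_domain P) (ul_rate P s l)"
    and ul_rate_nonneg: "X \<in> constraint_domain P \<Longrightarrow> ul_rate P s l X \<ge> 0"
proof -
  let ?k = "\<lambda>X. val X (K_ul (sigma P s) l)" and ?p = "\<lambda>X. val X (p_ul (sigma P s) l)"
  define c where "c = gain P (sigma P s) / (bandwidth P * N_0 P)"
  have c: "c \<ge> 0"
    using adm sigma_in_users[OF assms(1)] unfolding admissible_system_def c_def
    by (auto intro!: divide_nonneg_nonneg mult_nonneg_nonneg less_imp_le)
  have b: "bandwidth P / ln 2 \<ge> 0"
    using adm by (simp add: admissible_system_def)
  have vars: "K_ul (sigma P s) l \<in> resource_vars P" "p_ul (sigma P s) l \<in> power_vars P"
    using assms by (auto simp: resource_vars_def power_vars_def)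
  then have nn: "?k X \<ge> 0" "?p X \<ge> 0" if "X \<in> constraint_domain P" for X
    using that by (auto simp: constraint_domain_def)
  have eq: "ul_rate P s l X = (bandwidth P / ln 2) * (?k X * ln (1 + c * ?p X / ?k X))" for X
    by (simp add: ul_rate_eq c_def)
  show "concave_on (constraint_domain P) (ul_rate P s l)"
    unfolding eq[abs_def] by (intro concave_on_cmul b concave_on_perspective_ln c nn
      linear_val convex_constraint_domain)
  show "ul_rate P s l X \<ge> 0" if "X \<in> constraint_domain P"
    unfolding eq using c nn[OF that] b
    by (intro mult_nonneg_nonneg ln_ge_zero) auto
qed

lemma feasible_nonneg:
  assumes "X \<in> feasible_set (decision_space P) (constraint_set P Y)"
    "v \<in> session_vars P \<union> {T_idle} \<union> resource_vars P \<union> power_vars P"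
  shows "val X v \<ge> 0"
proof -
  have "nonneg_con v \<in> constraint_set P Y"
    using assms(2) by (auto simp: constraint_set_def)
  then show ?thesis
    using assms(1) by (auto simp: feasible_set_def nonneg_con_def)
qed

lemma feasible_subset_constraint_domain:
  "feasible_set (decision_space P) (constraint_set P Y) \<subseteq> constraint_domain P"
proof
  fix X assume X: "X \<in> feasible_set (decision_space P) (constraint_set P Y)"
  then have "X \<in> decision_space P" by (simp add: feasible_set_def)
  with feasible_nonneg[OF X] show "X \<in> constraint_domain P"
    unfolding constraint_domain_def by blast
qed

text \<open>The computation-time constraints bound every \<open>tau_cp\<close> below by a strictly
  positive constant.\<close>

lemma feasible_subset_objective_region:
  "feasible_set (decision_space P) (constraint_set P Y) \<subseteq> objective_region P"
proof
  fix X assume X: "X \<in> feasible_set (decision_space P) (constraint_set P Y)"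
  have "tau_cp P s X > 0" if s: "s \<in> {1..num_users P}" for s
  proof -
    have "comp_time_con P s \<in> constraint_set P Y"
      using s by (auto simp: constraint_set_def)
    then have "comp_time_con P s X \<ge> 0"
      using X by (simp add: feasible_set_def)
    moreover have "tau_min P (sigma P s) > 0"
      using adm sigma_in_users[OF s] by (simp add: admissible_system_def)
    ultimately show ?thesis
      by (simp add: comp_time_con_def)
  qed
  with X show "X \<in> objective_region P"
    by (simp add: objective_region_def feasible_set_def)
qed

section \<open>Convexity of the objective\<close>

lemma convex_on_energy:
  assumes "s \<in> {1..num_users P}"
  shows "convex_on (objective_region P) (energy P Y s)"
  unfolding energy_def
proof (intro convex_on_add convex_on_sum_functions convex_objective_region)
  let ?A = "objective_region P"
  have "convex_on ?A (\<lambda>X. 1 / (tau_cp P s X)\<^sup>2)"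
    by (rule convex_on_compose_linear[OF convex_on_inverse_power2 linear_tau_cp convex_objective_region])
      (use assms in \<open>auto simp: objective_region_def\<close>)
  moreover have "kappa P * alpha P ^ 3 * Theta P (sigma P s) ^ 3 \<ge> 0"
    using adm sigma_in_users[OF assms] by (simp add: admissible_system_def less_imp_le)
  ultimately have "convex_on ?A
      (\<lambda>X. kappa P * alpha P ^ 3 * Theta P (sigma P s) ^ 3 * (1 / (tau_cp P s X)\<^sup>2))"
    by (rule convex_on_cmul[rotated])
  then show "convex_on ?A (\<lambda>X. kappa P * alpha P ^ 3 * Theta P (sigma P s) ^ 3 / (tau_cp P s X)\<^sup>2)"
    by simp
  have sq: "convex_on ?A (\<lambda>X. (val X v)\<^sup>2)" for v
    by (rule convex_on_compose_linear[OF convex_power2 linear_val convex_objective_region]) simp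
  fix l assume "l \<in> {s..num_users P}"
  then have y: "y_E Y s l > 0"
    using pos_aux assms by (auto simp: positive_aux_def)
  then show "convex_on ?A (\<lambda>X. (val X (p_ul (sigma P s) l))\<^sup>2 / (2 * y_E Y s l))"
    by (intro convex_on_cdiv sq) simp
  show "convex_on ?A (\<lambda>X. y_E Y s l * (val X (t_ul l))\<^sup>2 / 2)"
    using y by (intro convex_on_cdiv convex_on_cmul sq) auto
qed

lemma convex_on_objective: "convex_on (objective_region P) (objective P Y)"
  unfolding objective_def
proof (intro convex_on_add convex_on_sum_functions convex_on_cmul convex_on_energy
    convex_on_linear linear_total_time convex_objective_region)
  show "lambda P (sigma P s) \<ge> 0" if "s \<in> {1..num_users P}" for s
    using adm sigma_in_users[OF that] by (simp add: admissible_system_def)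
qed

section \<open>Concavity or affinity of the constraints\<close>

lemma concave_ereal_on_hb_rate_con:
  assumes e: "e \<in> hb_users P"
  shows "concave_ereal_on (constraint_domain P) (hb_rate_con P Y e)"
  unfolding hb_rate_con_def
proof (intro concave_ereal_on_diff_ereal concave_ereal_on_add concave_ereal_on_sum
    concave_ereal_on_cmult concave_ereal_on_qt concave_ereal_on_ereal c_hb_nonneg[OF e]
    convex_constraint_domain concave_on_linear[OF linear_val])
  let ?A = "constraint_domain P"
  show "concave_on ?A (\<lambda>X. val X T_idle * r_max P e)"
    using concave_on_cmul[OF _ concave_on_linear[OF linear_val convex_constraint_domain], of "r_max P e" P T_idle]
      adm e by (simp add: admissible_system_def mult.commute)
  \<comment> \<open>The subtracted side is linear in the durations, so it has the convexity that a
    difference demands.\<close>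
  show "convex_on ?A (\<lambda>X. theta P * total_time P X)"
    using adm by (intro convex_on_cmul convex_on_linear linear_total_time convex_constraint_domain)
      (simp add: admissible_system_def)
  fix l assume l: "l \<in> {1..num_users P}"
  show "y_dl_hb Y e l \<ge> 0" "y_ul_hb Y e l \<ge> 0"
    using pos_aux e l by (auto simp: positive_aux_def less_imp_le)
  show "val X (K_dl_hb e l) \<ge> 0" "val X (K_ul_hb e l) \<ge> 0" if "X \<in> ?A" for X
    using that e l by (auto simp: constraint_domain_def resource_vars_def)
qed

lemma concave_ereal_on_dl_completion_con:
  assumes l: "l \<in> {1..num_users P}"
  shows "concave_ereal_on (constraint_domain P) (dl_completion_con P Y l)"
  unfolding dl_completion_con_def
proof (intro concave_ereal_on_diff_ereal concave_ereal_on_sum concave_ereal_on_cmult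
    concave_ereal_on_qt c_fl_nonneg[OF l] convex_constraint_domain concave_on_linear[OF linear_val])
  show "convex_on (constraint_domain P) (\<lambda>X. data_size P)"
    by (simp add: convex_on_const convex_constraint_domain)
  fix i assume i: "i \<in> {1..l}"
  \<comment> \<open>The auxiliary variables are positive only within the session range, which
    contains every \<open>i \<le> l\<close>.\<close>
  have "i \<in> {1..num_users P}"
    using i l by auto
  then show "y_dl Y i \<ge> 0"
    using pos_aux unfolding positive_aux_def by (meson less_imp_le)
  have "K_dl i \<in> resource_vars P"
    using i l by (auto simp: resource_vars_def)
  then show "val X (K_dl i) \<ge> 0" if "X \<in> constraint_domain P" for X
    using that by (simp add: constraint_domain_def)
qed

text \<open>The square root is applied to the rate itself; its concavity and nonnegativity on the
  domain are what \<open>concave_ereal_on_qt\<close> asks for.\<close>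

lemma concave_ereal_on_ul_completion_con:
  assumes s: "s \<in> {1..num_users P}"
  shows "concave_ereal_on (constraint_domain P) (ul_completion_con P Y s)"
  unfolding ul_completion_con_def
proof (intro concave_ereal_on_diff_ereal concave_ereal_on_sum concave_ereal_on_qt
    convex_constraint_domain concave_on_linear[OF linear_val] concave_on_ul_rate[OF s] ul_rate_nonneg[OF s])
  show "convex_on (constraint_domain P) (\<lambda>X. data_size P)"
    by (simp add: convex_on_const convex_constraint_domain)
  fix l assume l: "l \<in> {s..num_users P}"
  then have "l \<in> {1..num_users P}" "s \<in> {1..l}"
    using s by auto
  then show "y_ul Y s l \<ge> 0"
    using pos_aux unfolding positive_aux_def by (meson less_imp_le)
qed

text \<open>Only the high-bandwidth rate and the two completion families use concavity on the
  restricted domain; sharing, computation time and bounds on single variables are affine on the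
  whole space.\<close>

lemma affine_or_concave_constraint:
  assumes "G \<in> constraint_set P Y"
  shows "affine_fun_on (decision_space P) G \<or> concave_ereal_on (constraint_domain P) G"
proof -
  let ?V = "decision_space P"
  have dl: "affine_fun_on ?V (dl_sharing_con P l)" for l
    unfolding dl_sharing_con_def by (intro affine_fun_on_const_diff linear_val_intros ballI)
  have ul: "affine_fun_on ?V (ul_sharing_con P l)" for l
    unfolding ul_sharing_con_def by (intro affine_fun_on_const_diff linear_val_intros ballI)
  have tau: "affine_fun_on ?V (comp_time_con P s)" for s
    unfolding comp_time_con_def by (intro affine_fun_on_diff_const linear_tau_cp)
  have nonneg: "affine_fun_on ?V (nonneg_con v)" for v
    unfolding nonneg_con_def using affine_fun_on_diff_const[OF linear_val, of ?V v 0] by simp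
  have power: "affine_fun_on ?V (power_max_con P v)" for v
    unfolding power_max_con_def by (intro affine_fun_on_const_diff linear_val)
  show ?thesis
    using assms dl ul tau nonneg power concave_ereal_on_hb_rate_con
      concave_ereal_on_dl_completion_con concave_ereal_on_ul_completion_con
    unfolding constraint_set_def by blast
qed

lemma convex_problem_TP:
  "convex_problem (decision_space P) (objective_region P) (objective P Y)
     (constraint_domain P) (constraint_set P Y)"
  unfolding convex_problem_def
proof (intro conjI ballI affine_or_concave_constraint)
  show "objective_region P \<subseteq> decision_space P" "constraint_domain P \<subseteq> decision_space P"
    by (auto simp: objective_region_def constraint_domain_def)
qed (auto intro: subspace_decision_space feasible_subset_objective_region[THEN subsetD]
      feasible_subset_constraint_domain[THEN subsetD] convex_on_objective)

end

theorem theorem1: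
  fixes P :: "'e system" and Y :: "'e aux"
  assumes "admissible_system P" and "positive_aux P Y"
  shows "convex_problem (decision_space P) (objective_region P) (objective P Y)
           (constraint_domain P) (constraint_set P Y)
       \<and> convex (feasible_set (decision_space P) (constraint_set P Y))
       \<and> convex_on (feasible_set (decision_space P) (constraint_set P Y)) (objective P Y)"
proof (intro conjI)
  show conv: "convex_problem (decision_space P) (objective_region P) (objective P Y)
      (constraint_domain P) (constraint_set P Y)"
    by (rule convex_problem_TP[OF assms])
  then show feas: "convex (feasible_set (decision_space P) (constraint_set P Y))"
    by (rule convex_problem_feasible_set)
  \<comment> \<open>Convexity on the objective region restricts to the feasible set because that
    subset is itself convex.\<close>
  show "convex_on (feasible_set (decision_space P) (constraint_set P Y)) (objective P Y)"
    by (rule convex_on_subset[OF convex_on_objective[OF assms]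
          feasible_subset_objective_region[OF assms] feas])
qed

end
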